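(* Let $G$ be a Polish group and let $A\subset G$ be a non-empty $\sigma$-compact subset. Then $\mathrm{ind}_P(A)\in\mathbb{N}\cup\{\aleph_0,\mathfrak{c}\}$. Moreover, if the set $A$ is compact, then: (1) $\mathrm{ind}_P(A)=\mathfrak{c}$ if $G$ is not locally compact; (2) $\mathrm{ind}_P(A)\in\{\aleph_0,\mathfrak{c}\}$ if $G$ is locally compact but not compact; (3) $\mathrm{ind}_P(A)\in\mathbb{N}\cup\{\mathfrak{c}\}$ if $G$ is compact.
   Context: $\mathbb{N}$ is the set of positive integers and $\mathfrak{c}$ is the cardinality of the continuum. For a non-empty subset $A$ of a group $G$, the packing index of $A$ is the cardinal $$\mathrm{ind}_P(A)=\sup\{|S| : S\subset G \text{ and } \{xA\}_{x\in S}\text{ is disjoint}\},$$ where the family $\{xA\}_{x\in S}$ is called disjoint if $xA\cap yA=\emptyset$ for all distinct $x,y\in S$. *)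

theory Defs
  imports "HOL-Analysis.Analysis" "HOL-Algebra.Coset" "HOL-Library.Disjoint_Sets"
begin

unbundle cardinal_syntax
no_notation Set_Algebras.elt_set_eq (infix \<open>=o\<close> 50)

locale topological_group = group G for G (structure) and T +
  assumes topspace_eq_carrier: "topspace T = carrier G"
    and continuous_map_mult: "continuous_map (prod_topology T T) T (\<lambda>(x, y). x \<otimes> y)"
    and continuous_map_inv: "continuous_map T T (\<lambda>x. inv x)"

locale polish_group = topological_group +
  assumes separable: "separable_space T"
    and completely_metrizable: "completely_metrizable_space T"

definition sigma_compactin :: "'a topology \<Rightarrow> 'a set \<Rightarrow> bool" where
  "sigma_compactin T A \<longleftrightarrow> (countable union_of compactin T) A"


text \<open>
  Cardinals are represented, as in the library, by cardinal orders, up to the equivalence \<open>=o\<close>.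
  The supremum of a set of cardinals on a type \<open>'b\<close> is again represented on \<open>'b\<close>; the lemmas
  below show that it exists and that it is least among the upper bounds on every type.
\<close>

definition is_card_Sup :: "'b rel set \<Rightarrow> 'b rel \<Rightarrow> bool" where
  "is_card_Sup R k \<longleftrightarrow> Card_order k \<and> (\<forall>r\<in>R. r \<le>o k) \<and>
     (\<forall>k'::'b rel. Card_order k' \<and> (\<forall>r\<in>R. r \<le>o k') \<longrightarrow> k \<le>o k')"

definition card_Sup :: "'b rel set \<Rightarrow> 'b rel" where
  "card_Sup R = (SOME k. is_card_Sup R k)"

lemma is_card_Sup_card_Sup:
  fixes R :: "'b rel set"
  assumes "\<And>r. r \<in> R \<Longrightarrow> Card_order r"
  shows "is_card_Sup R (card_Sup R)"
proof -
  let ?U = "{k::'b rel. Card_order k \<and> (\<forall>r\<in>R. r \<le>o k)}"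
  have "r \<le>o |UNIV :: 'b set|" if "r \<in> R" for r
  proof -
    have "|Field r| =o r"
      using assms[OF that] by (rule card_of_Field_ordIso)
    moreover have "|Field r| \<le>o |UNIV :: 'b set|"
      by (rule card_of_mono1) simp
    ultimately show ?thesis
      by (rule ordIso_ordLeq_trans[OF ordIso_symmetric])
  qed
  then have "|UNIV :: 'b set| \<in> ?U"
    by (simp add: card_of_Card_order)
  then obtain k where "k \<in> ?U" "\<forall>k'\<in>?U. k \<le>o k'"
    using exists_minim_Card_order[of ?U] by blast
  then have "is_card_Sup R k"
    by (simp add: is_card_Sup_def)
  then show ?thesis
    unfolding card_Sup_def by (rule someI)
qed

lemma card_Sup_least:
  fixes R :: "'b rel set" and k' :: "'c rel"
  assumes "\<And>r. r \<in> R \<Longrightarrow> Card_order r" and "Card_order k'" and "\<And>r. r \<in> R \<Longrightarrow> r \<le>o k'"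
  shows "card_Sup R \<le>o k'"
proof (rule ccontr)
  have sup: "is_card_Sup R (card_Sup R)"
    using assms(1) by (rule is_card_Sup_card_Sup)
  then have co: "Card_order (card_Sup R)"
    by (simp add: is_card_Sup_def)
  assume "\<not> card_Sup R \<le>o k'"
  then have less: "k' <o card_Sup R"
    using not_ordLeq_iff_ordLess[OF card_order_on_well_order_on[OF assms(2)]
        card_order_on_well_order_on[OF co]] by simp
  have field: "|Field k'| =o k'"
    by (rule card_of_Field_ordIso[OF assms(2)])
  have "|Field k'| <o card_Sup R"
    by (rule ordIso_ordLess_trans[OF field less])
  then have "\<exists>B < Field (card_Sup R). |Field k'| =o |B| \<and> |B| <o card_Sup R"
    by (rule iffD1[OF internalize_card_of_ordLess])
  then obtain B :: "'b set" where B: "|Field k'| =o |B|"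
    by (elim exE conjE)
  define p where "p = |B|"
  have p: "Card_order p"
    unfolding p_def by (rule card_of_Card_order)
  have kp: "k' =o p"
    unfolding p_def by (rule ordIso_transitive[OF ordIso_symmetric[OF field] B])
  have "\<forall>r\<in>R. r \<le>o p"
    using ordLeq_ordIso_trans[OF assms(3) kp] by simp
  then have "card_Sup R \<le>o p"
    using sup p by (simp add: is_card_Sup_def)
  then have "card_Sup R \<le>o k'"
    by (rule ordLeq_ordIso_trans[OF _ ordIso_symmetric[OF kp]])
  then show False
    using \<open>\<not> card_Sup R \<le>o k'\<close> by simp
qed

definition packing_index :: "('a, 'm) monoid_scheme \<Rightarrow> 'a set \<Rightarrow> 'a rel" where
  "packing_index G A =
     card_Sup (card_of ` {S. S \<subseteq> carrier G \<and> disjoint_family_on (\<lambda>x. x <#\<^bsub>G\<^esub> A) S})"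

end

theory Submission
  imports Defs
begin

text \<open>
  Translates \<open>x A\<close> and \<open>y A\<close> are disjoint iff \<open>x\<^sup>-\<^sup>1 y \<notin> K\<close>, where \<open>K = A A\<^sup>-\<^sup>1\<close> is symmetric and
  contains the unit. So a packing is a clique of the graph that joins \<open>x\<close> and \<open>y\<close> when
  \<open>x\<^sup>-\<^sup>1 y \<notin> K\<close>, and the theorem is about the sizes of cliques.

  If \<open>A\<close> is \<open>\<sigma>\<close>-compact then so is \<open>K\<close>, hence the edge set is \<open>G\<^sub>\<delta>\<close>, an intersection of open sets
  \<open>U n\<close>. A clique without isolated points can then be fattened to a clique of size continuum
  by a Cantor scheme (\<open>cantor_scheme\<close>): split each of the finitely many points chosen so far into
  two nearby points of the clique and surround them by balls so small that any two points from
  different balls are joined in \<open>U n\<close>. Branches of the scheme converge, and two different branches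
  are joined in every \<open>U n\<close>. An uncountable clique contains a non-empty one without isolated points.
  So either some packing has size continuum, which is also the largest possible size, or
  all packings are countable and the supremum is finite or \<open>\<aleph>\<^sub>0\<close>.

  Let now \<open>A\<close>, and hence \<open>K\<close>, be compact. For a maximal packing \<open>S\<close> the translates \<open>x K\<close> with
  \<open>x \<in> S\<close> cover the group (\<open>maximal_packing_covers\<close>). If \<open>S\<close> is countable then, by Baire's theorem,
  some \<open>x K\<close> has interior points, so the group is locally compact; if \<open>S\<close> is finite, the
  group is compact.

  In a compact group, if \<open>K\<close> is a neighbourhood of the unit, finitely many small translates cover
  the group and each contains at most one point of a packing, so the packings are bounded in size
  (\<open>bounded_packings\<close>). Otherwise there are elements outside \<open>K\<close> arbitrarily close to the unit;
  multiplying points of a finite packing by such elements enlarges it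
  (\<open>extend_clique_nearby\<close>). Iterating gives a countable packing without isolated points, and the
  Cantor scheme turns it into one of size continuum.
\<close>

section \<open>Cliques of size continuum\<close>

text \<open>
  The initial segment of length \<open>n\<close> of \<open>\<alpha>\<close>, in reverse order: a node of the binary tree is a list,
  and its two children arise by adding a head.
\<close>

primrec branch :: "(nat \<Rightarrow> bool) \<Rightarrow> nat \<Rightarrow> bool list" where
  "branch \<alpha> 0 = []"
| "branch \<alpha> (Suc n) = \<alpha> n # branch \<alpha> n"

lemma length_branch [simp]: "length (branch \<alpha> n) = n"
  by (induction n) auto

lemma branch_eqD: "branch \<alpha> n = branch \<beta> n \<Longrightarrow> k < n \<Longrightarrow> \<alpha> k = \<beta> k"
  by (induction n) (auto simp: less_Suc_eq)

text \<open>
  One level of the Cantor scheme: \<open>V\<close> is the separation already achieved between the balls at the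
  nodes of level \<open>n\<close>, \<open>W\<close> the stronger one to be achieved at level \<open>n + 1\<close>. Irreflexivity of \<open>V\<close>
  makes the balls at level \<open>n\<close> disjoint, so that the new centres are distinct; as there are finitely
  many of them, one radius serves all pairs.
\<close>

lemma (in Metric_space) cantor_scheme_step:
  assumes D: "D \<subseteq> M"
    and acc: "\<And>x e. x \<in> D \<Longrightarrow> 0 < e \<Longrightarrow> \<exists>y\<in>D. y \<noteq> x \<and> d x y < e"
    and near: "\<And>x y. x \<in> D \<Longrightarrow> y \<in> D \<Longrightarrow> x \<noteq> y \<Longrightarrow>
      eventually (\<lambda>e. \<forall>x'\<in>mcball x e. \<forall>y'\<in>mcball y e. W x' y') (at_right 0)"
    and irrefl: "\<And>x. \<not> V x x"
    and r: "0 < r" and e: "0 < (e::real)"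
    and c: "\<And>s. length s = n \<Longrightarrow> c s \<in> D"
    and sep: "\<And>s t x y. length s = n \<Longrightarrow> length t = n \<Longrightarrow> s \<noteq> t \<Longrightarrow>
      x \<in> mcball (c s) r \<Longrightarrow> y \<in> mcball (c t) r \<Longrightarrow> V x y"
  obtains c' :: "bool list \<Rightarrow> 'a" and r' where "0 < r'" "r' \<le> e"
    and "\<And>s. length s = Suc n \<Longrightarrow> c' s \<in> D"
    and "\<And>s t x y. length s = Suc n \<Longrightarrow> length t = Suc n \<Longrightarrow> s \<noteq> t \<Longrightarrow>
      x \<in> mcball (c' s) r' \<Longrightarrow> y \<in> mcball (c' t) r' \<Longrightarrow> W x y"
    and "\<And>b s. length s = n \<Longrightarrow> mcball (c' (b # s)) r' \<subseteq> mcball (c s) r"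
proof -
  have "\<forall>s. \<exists>y. length s = n \<longrightarrow> y \<in> D \<and> y \<noteq> c s \<and> d (c s) y < r"
    using acc[OF c r] by blast
  then obtain z where z: "\<And>s. length s = n \<Longrightarrow> z s \<in> D \<and> z s \<noteq> c s \<and> d (c s) (z s) < r"
    by metis
  \<comment> \<open>one child keeps the centre of its parent, the other one moves to a nearby point of \<open>D\<close>\<close>
  define c' where "c' u = (if hd u then z (tl u) else c (tl u))" for u
  define L where "L = {u :: bool list. length u = Suc n}"
  have fin: "finite L"
    using finite_lists_length_eq[of "UNIV :: bool set" "Suc n"] by (simp add: L_def)
  have L: "hd u # tl u = u" "length (tl u) = n" if "u \<in> L" for u
    using that by (cases u; simp add: L_def)+
  have c'D: "c' u \<in> D" and c'r: "d (c (tl u)) (c' u) < r" if "u \<in> L" for u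
  proof -
    have "z (tl u) \<in> D" "c (tl u) \<in> D" "d (c (tl u)) (z (tl u)) < r"
      using z c L(2)[OF that] by blast+
    moreover from this have "d (c (tl u)) (c (tl u)) = 0"
      using D by (intro mdist_zero) blast
    ultimately show "c' u \<in> D" "d (c (tl u)) (c' u) < r"
      using r by (simp_all add: c'_def)
  qed
  have inj: "c' u \<noteq> c' v" if "u \<in> L" "v \<in> L" "u \<noteq> v" for u v
  proof (cases "tl u = tl v")
    case True
    have "hd u \<noteq> hd v"
    proof
      assume "hd u = hd v"
      then have "hd u # tl u = hd v # tl v"
        using True by simp
      then show False
        unfolding L(1)[OF that(1)] L(1)[OF that(2)] using that(3) by blast
    qed
    with True show ?thesis
      using z[OF L(2)[OF that(2)]] by (cases "hd u"; cases "hd v"; auto simp: c'_def)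
  next
    case False
    have "c' w \<in> mcball (c (tl w)) r" if "w \<in> L" for w
    proof -
      have "c (tl w) \<in> M" "c' w \<in> M"
        using c[OF L(2)[OF that]] c'D[OF that] D by blast+
      then show ?thesis
        using c'r[OF that] by simp
    qed
    with that have "c' u \<in> mcball (c (tl u)) r" "c' v \<in> mcball (c (tl v)) r"
      by blast+
    then have "V (c' u) (c' v)"
      using sep[OF L(2)[OF that(1)] L(2)[OF that(2)] False] by blast
    then show ?thesis
      using irrefl by metis
  qed
  have "\<forall>\<^sub>F r' in at_right 0. \<forall>u\<in>L. \<forall>v\<in>L. u \<noteq> v \<longrightarrow>
      (\<forall>x\<in>mcball (c' u) r'. \<forall>y\<in>mcball (c' v) r'. W x y)"
  proof (intro eventually_ball_finite[OF fin] ballI)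
    fix u v assume uv: "u \<in> L" "v \<in> L"
    show "\<forall>\<^sub>F r' in at_right 0. u \<noteq> v \<longrightarrow>
      (\<forall>x\<in>mcball (c' u) r'. \<forall>y\<in>mcball (c' v) r'. W x y)"
    proof (cases "u = v")
      case False
      show ?thesis
        using near[OF c'D[OF uv(1)] c'D[OF uv(2)] inj[OF uv False]]
        by (rule eventually_mono) blast
    qed simp
  qed
  moreover have "\<forall>\<^sub>F r' in at_right 0. \<forall>u\<in>L. r' \<le> r - d (c (tl u)) (c' u)"
  proof (intro eventually_ball_finite[OF fin] ballI)
    fix u assume "u \<in> L"
    then have "0 < r - d (c (tl u)) (c' u)"
      using c'r by simp
    then show "\<forall>\<^sub>F r' in at_right 0. r' \<le> r - d (c (tl u)) (c' u)"
      by (auto simp: eventually_at_right_field intro!: exI[of _ "r - d (c (tl u)) (c' u)"])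
  qed
  moreover have "\<forall>\<^sub>F r' in at_right 0. r' \<le> e"
    using e by (auto simp: eventually_at_right_field intro!: exI[of _ e])
  moreover have "\<forall>\<^sub>F r' in at_right 0. (0::real) < r'"
    by (rule eventually_at_right_less)
  ultimately have "\<forall>\<^sub>F r' in at_right 0. (0::real) < r' \<and> r' \<le> e \<and>
      (\<forall>u\<in>L. r' \<le> r - d (c (tl u)) (c' u)) \<and>
      (\<forall>u\<in>L. \<forall>v\<in>L. u \<noteq> v \<longrightarrow> (\<forall>x\<in>mcball (c' u) r'. \<forall>y\<in>mcball (c' v) r'. W x y))"
    by eventually_elim blast
  from eventually_happens'[OF trivial_limit_at_right_real this]
  obtain r' where r': "0 < r'" "r' \<le> e" "\<forall>u\<in>L. r' \<le> r - d (c (tl u)) (c' u)"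
    "\<forall>u\<in>L. \<forall>v\<in>L. u \<noteq> v \<longrightarrow> (\<forall>x\<in>mcball (c' u) r'. \<forall>y\<in>mcball (c' v) r'. W x y)"
    by (elim exE conjE) (rule that)
  show thesis
  proof (rule that[of r' c'])
    fix b and s :: "bool list" assume s: "length s = n"
    then have "r' \<le> r - d (c s) (c' (b # s))"
      using r'(3)[rule_format, of "b # s"] by (simp add: L_def)
    moreover have "c s \<in> M" "c' (b # s) \<in> M"
      using c c'D s D by (auto simp: L_def)
    ultimately have "d (c' (b # s)) (c s) + r' \<le> r"
      using commute[of "c' (b # s)" "c s"] by linarith
    then show "mcball (c' (b # s)) r' \<subseteq> mcball (c s) r"
      using \<open>c s \<in> M\<close> by (rule mcball_subset)
  next
    fix s t :: "bool list" and x y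
    assume "length s = Suc n" "length t = Suc n" "s \<noteq> t"
      and "x \<in> mcball (c' s) r'" "y \<in> mcball (c' t) r'"
    then show "W x y"
      using r'(4) unfolding L_def by blast
  qed (use r'(1,2) c'D in \<open>simp_all add: L_def\<close>)
qed

text \<open>
  The closed balls along a branch are nested with radii tending to zero, so by completeness each
  branch has a limit point. Limits of different branches lie in different balls from some level on,
  which gives \<open>V n\<close> for large \<open>n\<close>, and the relations \<open>V n\<close> shrink with \<open>n\<close>.
\<close>

lemma (in Metric_space) cantor_scheme:
  fixes V :: "nat \<Rightarrow> 'a \<Rightarrow> 'a \<Rightarrow> bool"
  assumes "mcomplete" and D: "D \<subseteq> M" "D \<noteq> {}"
    and acc: "\<And>x e. x \<in> D \<Longrightarrow> 0 < e \<Longrightarrow> \<exists>y\<in>D. y \<noteq> x \<and> d x y < e"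
    and near: "\<And>n x y. x \<in> D \<Longrightarrow> y \<in> D \<Longrightarrow> x \<noteq> y \<Longrightarrow>
      eventually (\<lambda>e. \<forall>x'\<in>mcball x e. \<forall>y'\<in>mcball y e. V n x' y') (at_right 0)"
    and irrefl: "\<And>n x. \<not> V n x x"
    and anti: "\<And>m n x y. m \<le> n \<Longrightarrow> V n x y \<Longrightarrow> V m x y"
  shows "\<exists>P\<subseteq>M. (UNIV :: real set) \<lesssim> P \<and> pairwise (\<lambda>x y. \<forall>n. V n x y) P"
proof -
  \<comment> \<open>a stage consists of the centres at the nodes of level \<open>n\<close> and their common radius\<close>
  define I where "I n p \<longleftrightarrow> (case p of (c :: bool list \<Rightarrow> 'a, r) \<Rightarrow> 0 < r \<and> r \<le> (1/2) ^ n \<and>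
      (\<forall>s. length s = n \<longrightarrow> c s \<in> D) \<and>
      (\<forall>s t. length s = n \<longrightarrow> length t = n \<longrightarrow> s \<noteq> t \<longrightarrow>
        (\<forall>x\<in>mcball (c s) r. \<forall>y\<in>mcball (c t) r. V n x y)))" for n p
  define J where "J n p q \<longleftrightarrow> (\<forall>b (s :: bool list). length s = n \<longrightarrow>
      mcball (fst q (b # s)) (snd q) \<subseteq> mcball (fst p s) (snd p))"
    for n and p q :: "(bool list \<Rightarrow> 'a) \<times> real"
  obtain x0 where "x0 \<in> D"
    using D by blast
  then have "I 0 (\<lambda>_. x0, 1)"
    by (simp add: I_def)
  moreover have "\<exists>q. I (Suc n) q \<and> J n p q" if "I n p" for n p
  proof -
    obtain c r where p: "p = (c, r)"
      by (cases p)
    have e: "(0::real) < (1/2) ^ Suc n" and r: "0 < r"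
      and c: "\<And>s. length s = n \<Longrightarrow> c s \<in> D"
      and sep: "\<And>s t x y. length s = n \<Longrightarrow> length t = n \<Longrightarrow> s \<noteq> t \<Longrightarrow>
        x \<in> mcball (c s) r \<Longrightarrow> y \<in> mcball (c t) r \<Longrightarrow> V n x y"
      using that by (auto simp: I_def p)
    show ?thesis
    proof (rule cantor_scheme_step[where D = D and V = "V n" and W = "V (Suc n)" and c = c
          and r = r and e = "(1/2) ^ Suc n" and n = n])
      fix c' r' assume *: "0 < r'" "r' \<le> (1/2) ^ Suc n"
        "\<And>s. length s = Suc n \<Longrightarrow> c' s \<in> D"
        "\<And>s t x y. length s = Suc n \<Longrightarrow> length t = Suc n \<Longrightarrow> s \<noteq> t \<Longrightarrow>
          x \<in> mcball (c' s) r' \<Longrightarrow> y \<in> mcball (c' t) r' \<Longrightarrow> V (Suc n) x y"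
        "\<And>b s. length s = n \<Longrightarrow> mcball (c' (b # s)) r' \<subseteq> mcball (c s) r"
      have "I (Suc n) (c', r')"
        unfolding I_def prod.case using * by blast
      moreover have "J n p (c', r')"
        using *(5) by (simp add: J_def p)
      ultimately show ?thesis
        by blast
    qed (fact D(1) acc near irrefl r e c sep)+
  qed
  ultimately obtain f where f: "\<And>n. I n (f n)" "\<And>n. J n (f n) (f (Suc n))"
    using dependent_nat_choice[of I J] by blast
  define B where "B \<alpha> n = mcball (fst (f n) (branch \<alpha> n)) (snd (f n))" for \<alpha> n
  have "\<exists>z. z \<in> (\<Inter>n. B \<alpha> n)" for \<alpha>
  proof -
    have "closedin mtopology (B \<alpha> n)" for n
      by (simp add: B_def)
    moreover have "B \<alpha> n \<noteq> {}" for n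
    proof -
      have "fst (f n) (branch \<alpha> n) \<in> M" "0 < snd (f n)"
        using f(1)[of n] D(1) by (auto simp: I_def split: prod.splits)
      then have "fst (f n) (branch \<alpha> n) \<in> B \<alpha> n"
        by (simp add: B_def)
      then show ?thesis
        by blast
    qed
    moreover have "decseq (B \<alpha>)"
      using f(2) by (intro decseq_SucI) (simp add: J_def B_def)
    moreover have "\<exists>n a. B \<alpha> n \<subseteq> mcball a \<epsilon>" if "\<epsilon> > 0" for \<epsilon>
    proof -
      obtain n where "(1/2) ^ n < \<epsilon>"
        using real_arch_pow_inv[of \<epsilon> "1/2"] \<open>\<epsilon> > 0\<close> by auto
      then have "snd (f n) \<le> \<epsilon>"
        using f(1)[of n] by (auto simp: I_def split: prod.splits)
      then show ?thesis
        unfolding B_def by (meson mcball_subset_concentric)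
    qed
    ultimately have "\<Inter> (range (B \<alpha>)) \<noteq> {}"
      using \<open>mcomplete\<close> unfolding mcomplete_nest by blast
    then show ?thesis
      by blast
  qed
  then obtain z where z: "\<And>\<alpha> n. z \<alpha> \<in> B \<alpha> n"
    by (metis INT_iff UNIV_I)
  have V: "V m (z \<alpha>) (z \<beta>)" if "\<alpha> \<noteq> \<beta>" for \<alpha> \<beta> m
  proof -
    obtain k where k: "\<alpha> k \<noteq> \<beta> k"
      using \<open>\<alpha> \<noteq> \<beta>\<close> by blast
    define n where "n = max m (Suc k)"
    have "branch \<alpha> n \<noteq> branch \<beta> n"
      using k branch_eqD[of \<alpha> n \<beta> k] by (metis n_def lessI less_le_trans max.cobounded2)
    then have "V n (z \<alpha>) (z \<beta>)"
      using f(1)[of n] z[of \<alpha> n] z[of \<beta> n] unfolding I_def B_def case_prod_beta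
      by (metis length_branch)
    then show ?thesis
      by (rule anti[rotated]) (simp add: n_def)
  qed
  then have inj: "inj z"
    using irrefl by (metis injI)
  have "(UNIV :: real set) \<lesssim> (UNIV :: nat set set)"
    using eqpoll_imp_lepoll eqpoll_sym nat_sets_eqpoll_reals by blast
  also have "\<dots> \<lesssim> range z"
    unfolding lepoll_def
  proof (intro exI conjI)
    show "inj (\<lambda>X :: nat set. z (\<lambda>n. n \<in> X))"
    proof (rule injI)
      fix X Y :: "nat set" assume "z (\<lambda>n. n \<in> X) = z (\<lambda>n. n \<in> Y)"
      then have "(\<lambda>n. n \<in> X) = (\<lambda>n. n \<in> Y)"
        by (rule injD[OF inj])
      then show "X = Y"
        by (auto simp: fun_eq_iff)
    qed
  qed blast
  finally have "(UNIV :: real set) \<lesssim> range z" .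
  moreover have "range z \<subseteq> M"
    using z by (force simp: B_def)
  moreover have "pairwise (\<lambda>x y. \<forall>n. V n x y) (range z)"
    using V by (intro pairwise_imageI) blast
  ultimately show ?thesis
    by blast
qed

text \<open>
  To get irreflexive relations that decrease with \<open>n\<close>, the scheme is run on \<open>x \<noteq> y\<close> together with
  membership of \<open>(x, y)\<close> in all of \<open>U 0, \<dots>, U n\<close>; these relations are open because the space is
  Hausdorff.
\<close>

lemma dense_in_itself_clique_imp_continuum_clique:
  fixes U :: "nat \<Rightarrow> ('a \<times> 'a) set"
  assumes "completely_metrizable_space T"
    and op: "\<And>n. openin (prod_topology T T) (U n)"
    and D: "D \<noteq> {}" "D \<subseteq> T derived_set_of D"
    and clique: "pairwise (\<lambda>x y. (x, y) \<in> (\<Inter>n. U n)) D"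
  shows "\<exists>P\<subseteq>topspace T. (UNIV :: real set) \<lesssim> P \<and> pairwise (\<lambda>x y. (x, y) \<in> (\<Inter>n. U n)) P"
proof -
  obtain M d where md: "Metric_space M d" "Metric_space.mcomplete M d" "T = Metric_space.mtopology M d"
    using assms(1) unfolding completely_metrizable_space_def by blast
  interpret Metric_space M d
    by (rule md(1))
  have T: "T = mtopology"
    by (rule md(3))
  have DM: "D \<subseteq> M"
    using D(2) derived_set_of_subset_topspace[of T D] by (simp add: T)
  define V where "V n x y \<longleftrightarrow> x \<noteq> y \<and> (\<forall>m\<le>n. (x, y) \<in> U m)" for n :: nat and x y
  have "\<exists>P\<subseteq>M. (UNIV :: real set) \<lesssim> P \<and> pairwise (\<lambda>x y. \<forall>n. V n x y) P"
  proof (rule cantor_scheme[OF md(2) DM D(1)])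
    fix x and e :: real assume "x \<in> D" "0 < e"
    then have "x \<in> mball x e" "openin mtopology (mball x e)" "x \<in> T derived_set_of D"
      using DM D(2) by auto
    then show "\<exists>y\<in>D. y \<noteq> x \<and> d x y < e"
      unfolding in_derived_set_of T by (metis in_mball)
  next
    fix n x y assume xy: "x \<in> D" "y \<in> D" "x \<noteq> y"
    have nbhd: "\<forall>\<^sub>F e in at_right 0. \<forall>x'\<in>mcball x e. \<forall>y'\<in>mcball y e. (x', y') \<in> W"
      if W: "openin (prod_topology T T) W" "(x, y) \<in> W" for W
    proof -
      obtain A B where AB: "openin mtopology A" "openin mtopology B" "x \<in> A" "y \<in> B" "A \<times> B \<subseteq> W"
        using W unfolding openin_prod_topology_alt T by metis
      obtain a where a: "0 < a" "mball x a \<subseteq> A"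
        using AB(1,3) by (auto simp: openin_mtopology)
      obtain b where b: "0 < b" "mball y b \<subseteq> B"
        using AB(2,4) by (auto simp: openin_mtopology)
      show ?thesis
        unfolding eventually_at_right_field
      proof (intro exI[of _ "min a b"] conjI allI impI ballI)
        show "0 < min a b"
          using a b by simp
        fix e x' y' assume e: "0 < e" "e < min a b" "x' \<in> mcball x e" "y' \<in> mcball y e"
        then have "x' \<in> mball x a" "y' \<in> mball y b"
          by auto
        then show "(x', y') \<in> W"
          using a b AB by blast
      qed
    qed
    have "\<forall>\<^sub>F e in at_right 0. \<forall>m\<in>{..n}. \<forall>x'\<in>mcball x e. \<forall>y'\<in>mcball y e. (x', y') \<in> U m"
      using clique xy by (intro eventually_ball_finite ballI nbhd op) (auto simp: pairwise_def)
    moreover have "\<forall>\<^sub>F e in at_right 0. \<forall>x'\<in>mcball x e. \<forall>y'\<in>mcball y e. (x', y') \<in> {p \<in> M \<times> M. fst p \<noteq> snd p}"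
    proof (rule nbhd)
      have "openin (prod_topology T T) (topspace (prod_topology T T) - (\<lambda>x. (x,x)) ` topspace T)"
        using Hausdorff_space_mtopology unfolding Hausdorff_space_closedin_diagonal T
        by (rule openin_diff[OF openin_topspace])
      also have "topspace (prod_topology T T) - (\<lambda>x. (x,x)) ` topspace T = {p \<in> M \<times> M. fst p \<noteq> snd p}"
        by (auto simp: T)
      finally show "openin (prod_topology T T) {p \<in> M \<times> M. fst p \<noteq> snd p}" .
    qed (use xy DM in auto)
    ultimately show "\<forall>\<^sub>F e in at_right 0. \<forall>x'\<in>mcball x e. \<forall>y'\<in>mcball y e. V n x' y'"
      by eventually_elim (auto simp: V_def)
  qed (auto simp: V_def)
  moreover have "pairwise (\<lambda>x y. (x, y) \<in> (\<Inter>n. U n)) P" if "pairwise (\<lambda>x y. \<forall>n. V n x y) P" for P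
    using that by (rule pairwise_mono) (auto simp: V_def)
  ultimately show ?thesis
    unfolding T topspace_mtopology by blast
qed

lemma separable_metrizable_imp_second_countable:
  assumes "metrizable_space T" "separable_space T"
  shows "second_countable T"
proof -
  obtain M d where md: "Metric_space M d" "T = Metric_space.mtopology M d"
    using assms(1) unfolding metrizable_space_def by blast
  interpret Metric_space M d
    by (rule md(1))
  obtain C where C: "countable C" "C \<subseteq> M" "mtopology closure_of C = M"
    using assms(2) by (auto simp: separable_space_def md(2))
  define \<B> where "\<B> = (\<lambda>(c, n). mball c (inverse (Suc n))) ` (C \<times> (UNIV :: nat set))"
  have "countable \<B>"
    unfolding \<B>_def using C(1) by auto
  moreover have "\<forall>V\<in>\<B>. openin mtopology V"
    by (auto simp: \<B>_def)
  moreover have "\<exists>V\<in>\<B>. x \<in> V \<and> V \<subseteq> U" if U: "openin mtopology U" "x \<in> U" for U x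
  proof -
    obtain r where r: "0 < r" "mball x r \<subseteq> U" and x: "x \<in> M"
      using U unfolding openin_mtopology by blast
    obtain n where n: "inverse (real (Suc n)) < r / 2"
      using reals_Archimedean[of "r/2"] r by auto
    have "x \<in> mtopology closure_of C"
      using C x by simp
    then have "\<forall>e>0. \<exists>c\<in>C. c \<in> mball x e"
      unfolding metric_closure_of by blast
    moreover have "0 < inverse (real (Suc n))"
      by simp
    ultimately obtain c where c: "c \<in> C" "c \<in> mball x (inverse (Suc n))"
      by blast
    then have dc: "d c x < inverse (Suc n)" "c \<in> M"
      by (simp_all add: commute)
    then have "mball c (inverse (Suc n)) \<subseteq> mball x r"
      using n x by (intro mball_subset) auto
    moreover have "x \<in> mball c (inverse (Suc n))"
      using dc x by simp
    moreover have "mball c (inverse (Suc n)) \<in> \<B>"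
      using c(1) unfolding \<B>_def by (intro image_eqI[of _ _ "(c, n)"]) auto
    ultimately show ?thesis
      using r(2) by blast
  qed
  ultimately show ?thesis
    unfolding second_countable_def md(2) by (intro exI[of _ \<B>] conjI allI impI) auto
qed

text \<open>
  A point is determined by the set of members of a countable base that contain it.
\<close>

lemma second_countable_t0_imp_lepoll_reals:
  assumes "second_countable T" "t0_space T"
  shows "topspace T \<lesssim> (UNIV :: real set)"
proof -
  obtain \<B> where \<B>: "countable \<B>" "\<And>V. V \<in> \<B> \<Longrightarrow> openin T V"
    "\<And>U x. openin T U \<Longrightarrow> x \<in> U \<Longrightarrow> \<exists>V\<in>\<B>. x \<in> V \<and> V \<subseteq> U"
    using assms(1) unfolding second_countable_def by metis
  have "inj_on (\<lambda>x. to_nat_on \<B> ` {V \<in> \<B>. x \<in> V}) (topspace T)"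
  proof (rule inj_onI, rule ccontr)
    fix x y assume xy: "x \<in> topspace T" "y \<in> topspace T" "x \<noteq> y"
      and eq: "to_nat_on \<B> ` {V \<in> \<B>. x \<in> V} = to_nat_on \<B> ` {V \<in> \<B>. y \<in> V}"
    have "{V \<in> \<B>. x \<in> V} = {V \<in> \<B>. y \<in> V}"
      using eq inj_on_to_nat_on[OF \<B>(1)] by (subst (asm) inj_on_image_eq_iff[of _ \<B>]) auto
    moreover obtain U where "openin T U" "x \<in> U \<longleftrightarrow> y \<notin> U"
      using assms(2) xy unfolding t0_space_def by blast
    ultimately show False
      using \<B>(3)[of U] by blast
  qed
  then have "topspace T \<lesssim> (UNIV :: nat set set)"
    unfolding lepoll_def by blast
  then show ?thesis
    using nat_sets_eqpoll_reals lepoll_trans2 by blast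
qed

text \<open>
  The half of the Cantor-Bendixson argument used for cliques: the points of \<open>S\<close> that have a basic
  neighbourhood with countable trace on \<open>S\<close> form a countable set; every neighbourhood of one of
  the other points meets \<open>S\<close> in an uncountable set, hence contains further points of this kind.
\<close>

lemma uncountable_imp_dense_in_itself_subset:
  assumes "second_countable T" "S \<subseteq> topspace T" "uncountable S"
  obtains D where "D \<subseteq> S" "D \<noteq> {}" "D \<subseteq> T derived_set_of D"
proof -
  obtain \<B> where \<B>: "countable \<B>" "\<And>V. V \<in> \<B> \<Longrightarrow> openin T V"
    "\<And>U x. openin T U \<Longrightarrow> x \<in> U \<Longrightarrow> \<exists>V\<in>\<B>. x \<in> V \<and> V \<subseteq> U"
    using assms(1) unfolding second_countable_def by metis
  define N where "N = (\<Union>V\<in>{V\<in>\<B>. countable (S \<inter> V)}. S \<inter> V)"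
  have N: "countable N"
    unfolding N_def using \<B>(1) by (intro countable_UN) (auto intro: countable_subset[of _ \<B>])
  have "S - N \<noteq> {}"
    using assms(3) N countable_subset[of S N] by auto
  moreover have "S - N \<subseteq> T derived_set_of (S - N)"
  proof
    fix x assume x: "x \<in> S - N"
    have "\<exists>y. y \<noteq> x \<and> y \<in> S - N \<and> y \<in> U" if U: "x \<in> U" "openin T U" for U
    proof -
      obtain V where V: "V \<in> \<B>" "x \<in> V" "V \<subseteq> U"
        using \<B>(3) U by blast
      then have "uncountable (S \<inter> V)"
        using x by (auto simp: N_def)
      moreover have "S \<inter> V \<subseteq> insert x N" if "\<not> ?thesis"
        using that V by blast
      ultimately show ?thesis
        using N countable_subset[of "S \<inter> V" "insert x N"] by auto
    qed
    then show "x \<in> T derived_set_of (S - N)"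
      using x assms(2) by (auto simp: in_derived_set_of)
  qed
  ultimately show thesis
    using that[of "S - N"] by blast
qed

text \<open>
  This dichotomy, due to Kubis, is what excludes indices strictly between \<open>\<aleph>\<^sub>0\<close> and the continuum
  without the continuum hypothesis.
\<close>

theorem uncountable_clique_imp_continuum_clique:
  fixes U :: "nat \<Rightarrow> ('a \<times> 'a) set"
  assumes "completely_metrizable_space T" "separable_space T"
    and "\<And>n. openin (prod_topology T T) (U n)"
    and "S \<subseteq> topspace T" "uncountable S"
    and clique: "pairwise (\<lambda>x y. (x, y) \<in> (\<Inter>n. U n)) S"
  shows "\<exists>P\<subseteq>topspace T. (UNIV :: real set) \<lesssim> P \<and> pairwise (\<lambda>x y. (x, y) \<in> (\<Inter>n. U n)) P"
proof -
  have "second_countable T"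
    using assms(1,2)
    by (intro separable_metrizable_imp_second_countable completely_metrizable_imp_metrizable_space)
  then obtain D where D: "D \<subseteq> S" "D \<noteq> {}" "D \<subseteq> T derived_set_of D"
    using assms(4,5) by (rule uncountable_imp_dense_in_itself_subset)
  show ?thesis
    using assms(1,3) D(2,3) pairwise_subset[OF clique D(1)]
    by (rule dense_in_itself_clique_imp_continuum_clique)
qed

text \<open>
  If finite cliques can be enlarged by new points arbitrarily close to any given member, then at stage
  \<open>n\<close> each point of the current finite clique receives a companion at distance less than
  \<open>1 / (n + 1)\<close>. A point survives in all later stages, so the union has no isolated points.
\<close>

lemma dense_in_itself_clique_exists:
  assumes "metrizable_space T" "topspace T \<noteq> {}"
    and ext: "\<And>F x W. finite F \<Longrightarrow> F \<subseteq> topspace T \<Longrightarrow> pairwise R F \<Longrightarrow> x \<in> F \<Longrightarrow>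
      openin T W \<Longrightarrow> x \<in> W \<Longrightarrow> \<exists>y\<in>W. y \<noteq> x \<and> pairwise R (insert y F)"
  obtains D where "D \<noteq> {}" "D \<subseteq> T derived_set_of D" "pairwise R D"
proof -
  obtain M d where md: "Metric_space M d" "T = Metric_space.mtopology M d"
    using assms(1) unfolding metrizable_space_def by blast
  interpret Metric_space M d
    by (rule md(1))
  have T: "T = mtopology"
    by (rule md(2))
  define I where "I F \<longleftrightarrow> finite F \<and> F \<subseteq> M \<and> F \<noteq> {} \<and> pairwise R F" for F
  define J where "J n F H \<longleftrightarrow> F \<subseteq> H \<and> (\<forall>x\<in>F. \<exists>y\<in>H. y \<noteq> x \<and> d x y < inverse (Suc n))" for n F H
  have step: "\<exists>H. I H \<and> F \<subseteq> H \<and> (\<forall>x\<in>F'. \<exists>y\<in>H. y \<noteq> x \<and> d x y < e)"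
    if "finite F'" "F' \<subseteq> F" "I F" "0 < e" for F F' e
    using that
  proof (induction F' rule: finite_induct)
    case (insert x F')
    then obtain H where H: "I H" "F \<subseteq> H" "\<forall>x\<in>F'. \<exists>y\<in>H. y \<noteq> x \<and> d x y < e"
      by auto
    have "x \<in> H" "x \<in> M"
      using H insert.prems by (auto simp: I_def)
    then have "\<exists>y\<in>mball x e. y \<noteq> x \<and> pairwise R (insert y H)"
      using H(1) \<open>0 < e\<close> by (intro ext) (auto simp: I_def T)
    then obtain y where y: "y \<in> mball x e" "y \<noteq> x" "pairwise R (insert y H)"
      by blast
    then show ?case
      using H y by (intro exI[of _ "insert y H"]) (auto simp: I_def)
  qed auto
  obtain x0 where "x0 \<in> M"
    using assms(2) by (auto simp: T)
  then have "\<exists>F. I F"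
    by (intro exI[of _ "{x0}"]) (auto simp: I_def)
  moreover have "\<exists>H. I H \<and> J n F H" if "I F" for n F
    using step[of F F "inverse (Suc n)"] that by (auto simp: I_def J_def)
  ultimately obtain f where f: "\<And>n. I (f n)" "\<And>n. J n (f n) (f (Suc n))"
    using dependent_nat_choice[of "\<lambda>_. I" J] by blast
  have mono: "f m \<subseteq> f n" if "m \<le> n" for m n
    using f(2) by (intro lift_Suc_mono_le[OF _ that]) (simp add: J_def)
  define D where "D = (\<Union>n. f n)"
  have "D \<noteq> {}" "D \<subseteq> M"
    using f(1) by (auto simp: D_def I_def)
  moreover have "D \<subseteq> T derived_set_of D"
  proof
    fix x assume "x \<in> D"
    then obtain m where m: "x \<in> f m"
      by (auto simp: D_def)
    have "\<exists>y. y \<noteq> x \<and> y \<in> D \<and> y \<in> W" if W: "x \<in> W" "openin mtopology W" for W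
    proof -
      obtain r where r: "0 < r" "mball x r \<subseteq> W"
        using W by (auto simp: openin_mtopology)
      obtain k where k: "inverse (real (Suc k)) < r"
        using reals_Archimedean r by blast
      define n where "n = max m k"
      have "x \<in> f n"
        using m mono[of m n] by (auto simp: n_def)
      then obtain y where y: "y \<in> f (Suc n)" "y \<noteq> x" "d x y < inverse (Suc n)"
        using f(2)[of n] by (auto simp: J_def)
      have "inverse (real (Suc n)) \<le> inverse (real (Suc k))"
        by (simp add: n_def)
      then have "d x y < r"
        using y(3) k by linarith
      moreover have "x \<in> M" "y \<in> M"
        using y(1) f(1)[of "Suc n"] \<open>x \<in> D\<close> \<open>D \<subseteq> M\<close> by (auto simp: I_def)
      ultimately have "y \<in> mball x r"
        by simp
      then show ?thesis
        using y(1,2) r(2) unfolding D_def by blast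
    qed
    then show "x \<in> T derived_set_of D"
      using \<open>x \<in> D\<close> \<open>D \<subseteq> M\<close> by (auto simp: in_derived_set_of T)
  qed
  moreover have "pairwise R D"
  proof (rule pairwiseI)
    fix x y assume "x \<in> D" "y \<in> D" "x \<noteq> y"
    then obtain m n where "x \<in> f m" "y \<in> f n"
      by (auto simp: D_def)
    then have "x \<in> f (max m n)" "y \<in> f (max m n)"
      using mono[of m "max m n"] mono[of n "max m n"] by auto
    then show "R x y"
      using f(1)[of "max m n"] \<open>x \<noteq> y\<close> by (auto simp: I_def pairwise_def)
  qed
  ultimately show thesis
    using that by blast
qed

section \<open>Suprema of cardinalities\<close>

lemma is_card_Sup_card_of: "is_card_Sup (card_of ` \<S>) (card_Sup (card_of ` \<S>))"
  by (rule is_card_Sup_card_Sup) (auto simp: card_of_Card_order)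

lemma card_of_le_card_Sup: "S \<in> \<S> \<Longrightarrow> |S| \<le>o card_Sup (card_of ` \<S>)"
  using is_card_Sup_card_of[of \<S>] by (simp add: is_card_Sup_def)

lemma card_Sup_le_card_of:
  assumes "\<And>S. S \<in> \<S> \<Longrightarrow> S \<lesssim> B"
  shows "card_Sup (card_of ` \<S>) \<le>o |B|"
proof (rule card_Sup_least)
  fix r assume "r \<in> card_of ` \<S>"
  then show "r \<le>o |B|"
    using assms by (auto simp: lepoll_def card_of_ordLeq[symmetric])
qed (auto simp: card_of_Card_order)

lemma card_Sup_eq_card_of:
  assumes "S \<in> \<S>" "B \<lesssim> S" "\<And>S. S \<in> \<S> \<Longrightarrow> S \<lesssim> B"
  shows "card_Sup (card_of ` \<S>) =o |B|"
proof -
  have "|B| \<le>o |S|"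
    using assms(2) by (auto simp: lepoll_def card_of_ordLeq[symmetric])
  then have "|B| \<le>o card_Sup (card_of ` \<S>)"
    using card_of_le_card_Sup[OF assms(1)] by (rule ordLeq_transitive)
  then show ?thesis
    using card_Sup_le_card_of[OF assms(3)] by (simp add: ordIso_iff_ordLeq)
qed

text \<open>
  Under a common finite bound the supremum is the maximum, attained by a largest member.
\<close>

lemma card_Sup_finite:
  assumes "S \<in> \<S>" "S \<noteq> {}" and N: "\<And>S. S \<in> \<S> \<Longrightarrow> finite S \<and> card S \<le> N"
  shows "\<exists>n::nat. n > 0 \<and> card_Sup (card_of ` \<S>) =o |{..<n}|"
proof -
  have "card ` \<S> \<subseteq> {..N}"
    using N by blast
  then have fin: "finite (card ` \<S>)"
    by (rule finite_subset) simp
  define n where "n = Max (card ` \<S>)"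
  have "n \<in> card ` \<S>"
    unfolding n_def using fin assms(1) by (intro Max_in) auto
  then obtain S' where S': "S' \<in> \<S>" "card S' = n"
    by auto
  have max: "card S \<le> n" if "S \<in> \<S>" for S
    unfolding n_def using fin that by (intro Max_ge) auto
  have "0 < card S"
    using N[OF assms(1)] assms(2) by (simp add: card_gt_0_iff)
  then have "0 < n"
    using max[OF assms(1)] by simp
  moreover have "card_Sup (card_of ` \<S>) =o |{..<n}|"
  proof (rule card_Sup_eq_card_of[OF S'(1)])
    show "{..<n} \<lesssim> S'"
      using N[OF S'(1)] S'(2) by (simp add: lepoll_iff_card_le)
    show "S \<lesssim> {..<n}" if "S \<in> \<S>" for S
      using N[OF that] max[OF that] by (simp add: lepoll_iff_card_le)
  qed
  ultimately show ?thesis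
    by blast
qed

text \<open>
  A finite supremum would bound the sizes of all members, so unboundedly large finite sets already
  force the supremum up to \<open>\<aleph>\<^sub>0\<close>.
\<close>

lemma card_Sup_countable:
  assumes "\<And>S. S \<in> \<S> \<Longrightarrow> countable S"
    and unbounded: "\<nexists>N. \<forall>S\<in>\<S>. finite S \<and> card S \<le> N"
  shows "card_Sup (card_of ` \<S>) =o |UNIV :: nat set|"
proof -
  define k where "k = card_Sup (card_of ` \<S>)"
  have "Card_order k"
    using is_card_Sup_card_of[of \<S>] by (simp add: is_card_Sup_def k_def)
  then have k: "|Field k| =o k"
    by (rule card_of_Field_ordIso)
  have S: "S \<lesssim> Field k" if "S \<in> \<S>" for S
  proof -
    have "|S| \<le>o |Field k|"
      using card_of_le_card_Sup[OF that] ordIso_symmetric[OF k]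
      unfolding k_def by (rule ordLeq_ordIso_trans)
    then show ?thesis
      by (simp add: lepoll_def card_of_ordLeq[symmetric])
  qed
  have "infinite (Field k)"
  proof
    assume fin: "finite (Field k)"
    have "finite S \<and> card S \<le> card (Field k)" if "S \<in> \<S>" for S
      using S[OF that] fin lepoll_iff_card_le[of S "Field k"]
      by (auto simp: lepoll_def intro: inj_on_finite)
    then show False
      using unbounded by blast
  qed
  then have "|UNIV :: nat set| \<le>o |Field k|"
    by (simp add: infinite_iff_card_of_nat)
  then have "|UNIV :: nat set| \<le>o k"
    using k by (rule ordLeq_ordIso_trans)
  moreover have "k \<le>o |UNIV :: nat set|"
    unfolding k_def using assms(1)
    by (intro card_Sup_le_card_of) (auto simp: countable_def lepoll_def)
  ultimately show ?thesis
    by (simp add: ordIso_iff_ordLeq k_def)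
qed

section \<open>Packings in groups\<close>

definition quotients :: "('a, 'm) monoid_scheme \<Rightarrow> 'a set \<Rightarrow> 'a set \<Rightarrow> 'a set" where
  "quotients G A B = (\<lambda>(a, b). a \<otimes>\<^bsub>G\<^esub> inv\<^bsub>G\<^esub> b) ` (A \<times> B)"

definition packings :: "('a, 'm) monoid_scheme \<Rightarrow> 'a set \<Rightarrow> 'a set set" where
  "packings G A = {S. S \<subseteq> carrier G \<and> disjoint_family_on (\<lambda>x. x <#\<^bsub>G\<^esub> A) S}"

lemma packing_index_eq: "packing_index G A = card_Sup (card_of ` packings G A)"
  by (simp add: packing_index_def packings_def)

context group
begin

lemma quotients_closed: "A \<subseteq> carrier G \<Longrightarrow> B \<subseteq> carrier G \<Longrightarrow> quotients G A B \<subseteq> carrier G"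
  by (auto simp: quotients_def subset_iff)

lemma one_in_quotients: "A \<subseteq> carrier G \<Longrightarrow> A \<noteq> {} \<Longrightarrow> \<one> \<in> quotients G A A"
  by (force simp: quotients_def)

lemma inv_in_quotients:
  assumes "A \<subseteq> carrier G" "g \<in> quotients G A A"
  shows "inv g \<in> quotients G A A"
proof -
  obtain a b where ab: "a \<in> A" "b \<in> A" "g = a \<otimes> inv b"
    using assms(2) by (auto simp: quotients_def)
  then have "inv g = b \<otimes> inv a"
    using assms(1) by (simp add: inv_mult_group subset_iff)
  then show ?thesis
    using ab by (force simp: quotients_def)
qed

lemma inv_ldiv: "x \<in> carrier G \<Longrightarrow> y \<in> carrier G \<Longrightarrow> inv (inv x \<otimes> y) = inv y \<otimes> x"
  by (simp add: inv_mult_group)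

lemma l_coset_mem_iff:
  assumes "x \<in> carrier G" "y \<in> carrier G" "B \<subseteq> carrier G"
  shows "y \<in> x <# B \<longleftrightarrow> inv x \<otimes> y \<in> B"
proof
  assume "y \<in> x <# B"
  then obtain b where b: "b \<in> B" "y = x \<otimes> b"
    by (auto simp: l_coset_def)
  then have "inv x \<otimes> y = b"
    using assms(1,3) by (simp add: m_assoc[symmetric] subset_iff)
  then show "inv x \<otimes> y \<in> B"
    using b(1) by simp
next
  assume "inv x \<otimes> y \<in> B"
  moreover have "y = x \<otimes> (inv x \<otimes> y)"
    using assms by (simp add: m_assoc[symmetric])
  ultimately show "y \<in> x <# B"
    unfolding l_coset_def by blast
qed

lemma translates_disjoint_iff:
  assumes "A \<subseteq> carrier G" "x \<in> carrier G" "y \<in> carrier G"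
  shows "(x <# A) \<inter> (y <# A) = {} \<longleftrightarrow> inv x \<otimes> y \<notin> quotients G A A"
proof -
  have eq: "x \<otimes> a = y \<otimes> b \<longleftrightarrow> inv x \<otimes> y = a \<otimes> inv b" if "a \<in> A" "b \<in> A" for a b
  proof -
    have [simp]: "a \<in> carrier G" "b \<in> carrier G"
      using that assms by auto
    have "inv x \<otimes> y = a \<otimes> inv b \<longleftrightarrow> y = x \<otimes> (a \<otimes> inv b)"
      using assms by (intro inv_solve_left') auto
    also have "\<dots> \<longleftrightarrow> y = (x \<otimes> a) \<otimes> inv b"
      using assms by (simp add: m_assoc)
    also have "\<dots> \<longleftrightarrow> x \<otimes> a = y \<otimes> b"
      using assms by (subst inv_solve_right) auto
    finally show ?thesis
      by simp
  qed
  have "(x <# A) \<inter> (y <# A) = {} \<longleftrightarrow> (\<forall>a\<in>A. \<forall>b\<in>A. x \<otimes> a \<noteq> y \<otimes> b)"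
    unfolding l_coset_def by blast
  also have "\<dots> \<longleftrightarrow> (\<forall>a\<in>A. \<forall>b\<in>A. inv x \<otimes> y \<noteq> a \<otimes> inv b)"
    by (simp add: eq)
  also have "\<dots> \<longleftrightarrow> inv x \<otimes> y \<notin> quotients G A A"
    by (auto simp: quotients_def)
  finally show ?thesis .
qed

lemma packings_iff_clique:
  assumes "A \<subseteq> carrier G"
  shows "S \<in> packings G A \<longleftrightarrow>
    S \<subseteq> carrier G \<and> pairwise (\<lambda>x y. inv x \<otimes> y \<notin> quotients G A A) S"
  unfolding packings_def disjoint_family_on_def pairwise_def mem_Collect_eq
  by (rule conj_cong[OF refl], intro ball_cong imp_cong refl translates_disjoint_iff[OF assms]) auto

lemma packing_index_finite:
  assumes "\<exists>N. \<forall>S\<in>packings G A. finite S \<and> card S \<le> N"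
  shows "\<exists>n::nat. n > 0 \<and> packing_index G A =o |{..<n}|"
proof -
  obtain N where N: "\<And>S. S \<in> packings G A \<Longrightarrow> finite S \<and> card S \<le> N"
    using assms by blast
  have "{\<one>} \<in> packings G A"
    by (simp add: packings_def disjoint_family_on_def)
  from card_Sup_finite[OF this _ N] show ?thesis
    unfolding packing_index_eq by blast
qed

text \<open>
  A point outside all translates \<open>x A A\<^sup>-\<^sup>1\<close> could be added to a packing \<open>S\<close> maximal by Zorn's lemma.
\<close>

lemma maximal_packing_covers:
  assumes A: "A \<subseteq> carrier G" "A \<noteq> {}"
  obtains S where "S \<in> packings G A" "(\<Union>x\<in>S. x <# quotients G A A) = carrier G"
proof -
  let ?K = "quotients G A A"
  have "\<exists>S\<in>packings G A. \<forall>X\<in>packings G A. S \<subseteq> X \<longrightarrow> X = S"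
  proof (rule subset_Zorn_nonempty)
    show "packings G A \<noteq> {}"
      by (auto simp: packings_def disjoint_family_on_def)
    fix \<C> assume C: "\<C> \<noteq> {}" "subset.chain (packings G A) \<C>"
    show "\<Union>\<C> \<in> packings G A"
      unfolding packings_iff_clique[OF A(1)]
    proof
      show "\<Union>\<C> \<subseteq> carrier G"
        using C(2) by (auto simp: subset_chain_def packings_def)
      show "pairwise (\<lambda>x y. inv x \<otimes> y \<notin> ?K) (\<Union>\<C>)"
      proof (rule pairwise_chain_Union)
        show "pairwise (\<lambda>x y. inv x \<otimes> y \<notin> ?K) S" if "S \<in> \<C>" for S
          using that C(2) packings_iff_clique[OF A(1)] by (auto simp: subset_chain_def)
        show "chain\<^sub>\<subseteq> \<C>"
          using C(2) by (auto simp: subset_chain_def chain_subset_def)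
      qed
    qed
  qed
  then obtain S where S: "S \<in> packings G A" "\<And>X. X \<in> packings G A \<Longrightarrow> S \<subseteq> X \<Longrightarrow> X = S"
    by blast
  then have SG: "S \<subseteq> carrier G"
    by (simp add: packings_def)
  have "\<exists>x\<in>S. inv x \<otimes> y \<in> ?K" if y: "y \<in> carrier G" for y
  proof (rule ccontr)
    assume no: "\<not> ?thesis"
    have "inv y \<otimes> x \<notin> ?K" if "x \<in> S" for x
      using no that inv_in_quotients[OF A(1), of "inv y \<otimes> x"] inv_ldiv[OF y, of x] SG by auto
    with no y S(1) have "insert y S \<in> packings G A"
      by (auto simp: packings_iff_clique[OF A(1)] pairwise_insert)
    then have "y \<in> S"
      using S(2) by blast
    then show False
      using no one_in_quotients[OF A] y by auto
  qed
  then have "y \<in> (\<Union>x\<in>S. x <# ?K)" if "y \<in> carrier G" for y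
    using that SG l_coset_mem_iff[OF _ that quotients_closed[OF A(1) A(1)]] by blast
  moreover have "x <# ?K \<subseteq> carrier G" if "x \<in> S" for x
    using quotients_closed[OF A(1) A(1)] by (rule l_coset_subset_G) (use that SG in blast)
  ultimately have "(\<Union>x\<in>S. x <# ?K) = carrier G"
    by (intro equalityI subsetI) auto
  with S(1) show thesis
    by (rule that)
qed

end

section \<open>Packings in topological groups\<close>

context topological_group
begin

lemma continuous_map_ldiv: "continuous_map (prod_topology T T) T (\<lambda>p. inv (fst p) \<otimes> snd p)"
proof -
  have "continuous_map (prod_topology T T) (prod_topology T T) (\<lambda>p. (inv (fst p), snd p))"
    by (intro continuous_map_pairedI continuous_map_snd
        continuous_map_compose[OF continuous_map_fst continuous_map_inv, unfolded o_def])
  from continuous_map_compose[OF this continuous_map_mult] show ?thesis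
    by (simp add: o_def)
qed

lemma continuous_map_rdiv: "continuous_map (prod_topology T T) T (\<lambda>p. fst p \<otimes> inv (snd p))"
proof -
  have "continuous_map (prod_topology T T) (prod_topology T T) (\<lambda>p. (fst p, inv (snd p)))"
    by (intro continuous_map_pairedI continuous_map_fst
        continuous_map_compose[OF continuous_map_snd continuous_map_inv, unfolded o_def])
  from continuous_map_compose[OF this continuous_map_mult] show ?thesis
    by (simp add: o_def)
qed

lemma continuous_map_translation:
  assumes "x \<in> carrier G"
  shows "continuous_map T T (\<lambda>y. x \<otimes> y)"
proof -
  have "continuous_map T (prod_topology T T) (\<lambda>y. (x, y))"
    using assms by (intro continuous_map_pairedI) (auto simp: topspace_eq_carrier)
  from continuous_map_compose[OF this continuous_map_mult] show ?thesis
    by (simp add: o_def)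
qed

lemma compactin_quotients:
  assumes "compactin T A" "compactin T B"
  shows "compactin T (quotients G A B)"
proof -
  have "compactin (prod_topology T T) (A \<times> B)"
    using assms by (simp add: compactin_Times)
  from image_compactin[OF this continuous_map_rdiv] show ?thesis
    by (simp add: quotients_def case_prod_beta)
qed

lemma compactin_translate:
  assumes "compactin T K" "x \<in> carrier G"
  shows "compactin T (x <# K)"
proof -
  have "x <# K = (\<lambda>y. x \<otimes> y) ` K"
    by (auto simp: l_coset_def)
  then show ?thesis
    using image_compactin[OF assms(1) continuous_map_translation[OF assms(2)]] by simp
qed

lemma openin_translate:
  assumes "openin T W" "x \<in> carrier G"
  shows "openin T (x <# W)"
proof -
  have W: "W \<subseteq> carrier G"
    using openin_subset[OF assms(1)] topspace_eq_carrier by simp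
  have "x <# W = {y \<in> topspace T. inv x \<otimes> y \<in> W}"
    using l_coset_mem_iff[OF assms(2) _ W] l_coset_subset_G[OF W assms(2)]
    by (auto simp: topspace_eq_carrier)
  also have "openin T \<dots>"
    using continuous_map_translation[of "inv x"] assms by (intro openin_continuous_map_preimage) auto
  finally show ?thesis .
qed

lemma openin_ldiv_notin:
  assumes "closedin T K"
  shows "openin (prod_topology T T) {p \<in> carrier G \<times> carrier G. inv (fst p) \<otimes> snd p \<notin> K}"
proof -
  have "openin (prod_topology T T) {p \<in> topspace (prod_topology T T). inv (fst p) \<otimes> snd p \<in> topspace T - K}"
    using assms by (intro openin_continuous_map_preimage[OF continuous_map_ldiv]) auto
  also have "{p \<in> topspace (prod_topology T T). inv (fst p) \<otimes> snd p \<in> topspace T - K} =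
      {p \<in> carrier G \<times> carrier G. inv (fst p) \<otimes> snd p \<notin> K}"
    by (auto simp: topspace_eq_carrier)
  finally show ?thesis .
qed

lemma locally_compact_if_compact_nbhd:
  assumes "compactin T K" "openin T W" "W \<noteq> {}" "W \<subseteq> K"
  shows "locally_compact_space T"
  unfolding locally_compact_space_def
proof
  fix g assume "g \<in> topspace T"
  then have g: "g \<in> carrier G"
    by (simp add: topspace_eq_carrier)
  obtain w where w: "w \<in> W"
    using assms(3) by blast
  then have wG: "w \<in> carrier G"
    using openin_subset[OF assms(2)] by (auto simp: topspace_eq_carrier)
  define x where "x = g \<otimes> inv w"
  have x: "x \<in> carrier G" "x \<otimes> w = g"
    using g wG by (auto simp: x_def m_assoc)
  have "g \<in> x <# W" "x <# W \<subseteq> x <# K"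
    using x w assms(4) by (auto simp: l_coset_def)
  then show "\<exists>U K. openin T U \<and> compactin T K \<and> g \<in> U \<and> U \<subseteq> K"
    using openin_translate[OF assms(2) x(1)] compactin_translate[OF assms(1) x(1)] by blast
qed

text \<open>
  Choose a neighbourhood \<open>N\<close> of the unit with \<open>N\<^sup>-\<^sup>1 N \<subseteq> A A\<^sup>-\<^sup>1\<close>. A translate of \<open>N\<close> contains at
  most one point of a packing, so the number of translates needed to cover the group is a bound.
\<close>

lemma bounded_packings:
  assumes "compact_space T" "A \<subseteq> carrier G" and U: "openin T U" "\<one> \<in> U" "U \<subseteq> quotients G A A"
  shows "\<exists>N. \<forall>S\<in>packings G A. finite S \<and> card S \<le> N"
proof -
  have "openin (prod_topology T T) {p \<in> topspace (prod_topology T T). inv (fst p) \<otimes> snd p \<in> U}"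
    by (rule openin_continuous_map_preimage[OF continuous_map_ldiv U(1)])
  moreover have "(\<one>, \<one>) \<in> {p \<in> topspace (prod_topology T T). inv (fst p) \<otimes> snd p \<in> U}"
    using U(2) by (simp add: topspace_eq_carrier)
  ultimately obtain V W where VW: "openin T V" "openin T W" "\<one> \<in> V" "\<one> \<in> W"
    "V \<times> W \<subseteq> {p \<in> topspace (prod_topology T T). inv (fst p) \<otimes> snd p \<in> U}"
    unfolding openin_prod_topology_alt by meson
  define N where "N = V \<inter> W"
  have N: "openin T N" "\<one> \<in> N" and div: "\<And>a b. a \<in> N \<Longrightarrow> b \<in> N \<Longrightarrow> inv a \<otimes> b \<in> U"
    using VW by (auto simp: N_def)
  have NG: "N \<subseteq> carrier G"
    using openin_subset[OF N(1)] by (simp add: topspace_eq_carrier)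
  have "\<exists>\<F>. finite \<F> \<and> \<F> \<subseteq> (\<lambda>x. x <# N) ` carrier G \<and> topspace T \<subseteq> \<Union>\<F>"
  proof (rule compactinD)
    show "compactin T (topspace T)"
      using assms(1) by (simp add: compact_space_def)
    show "openin T V" if "V \<in> (\<lambda>x. x <# N) ` carrier G" for V
      using that openin_translate[OF N(1)] by auto
    have "x \<in> x <# N" if "x \<in> carrier G" for x
      using that N NG by (simp add: l_coset_mem_iff)
    then show "topspace T \<subseteq> \<Union> ((\<lambda>x. x <# N) ` carrier G)"
      by (auto simp: topspace_eq_carrier)
  qed
  then obtain F where F: "finite F" "F \<subseteq> carrier G" "carrier G \<subseteq> (\<Union>x\<in>F. x <# N)"
    using finite_subset_image[of _ "\<lambda>x. x <# N" "carrier G"] unfolding topspace_eq_carrier by metis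
  have "finite S \<and> card S \<le> card F" if "S \<in> packings G A" for S
  proof -
    have S: "S \<subseteq> carrier G" "pairwise (\<lambda>x y. inv x \<otimes> y \<notin> quotients G A A) S"
      using that packings_iff_clique[OF assms(2)] by auto
    have "\<forall>s\<in>S. \<exists>x\<in>F. s \<in> x <# N"
      using S F by blast
    then obtain c where c: "\<And>s. s \<in> S \<Longrightarrow> c s \<in> F \<and> s \<in> c s <# N"
      by metis
    have "inj_on c S"
    proof (rule inj_onI, rule ccontr)
      fix s t assume st: "s \<in> S" "t \<in> S" "c s = c t" "s \<noteq> t"
      define x where "x = c s"
      have xst: "x \<in> F" "s \<in> x <# N" "t \<in> x <# N"
        using c[OF st(1)] c[OF st(2)] st(3) by (simp_all add: x_def)
      have G: "x \<in> carrier G" "s \<in> carrier G" "t \<in> carrier G"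
        using xst(1) st S(1) F(2) by auto
      then have "inv x \<otimes> s \<in> N" "inv x \<otimes> t \<in> N"
        using xst l_coset_mem_iff NG by blast+
      then have "inv (inv x \<otimes> s) \<otimes> (inv x \<otimes> t) \<in> U"
        by (rule div)
      moreover have "x \<otimes> (inv x \<otimes> t) = t"
        using G by (simp add: m_assoc[symmetric])
      then have "inv (inv x \<otimes> s) \<otimes> (inv x \<otimes> t) = inv s \<otimes> t"
        using G by (simp add: inv_ldiv m_assoc)
      ultimately have "inv s \<otimes> t \<in> quotients G A A"
        using U(3) by auto
      then show False
        using S(2) st by (auto simp: pairwise_def)
    qed
    moreover have "c ` S \<subseteq> F"
      using c by blast
    ultimately show ?thesis
      using F(1) by (meson card_inj_on_le inj_on_finite)
  qed
  then show ?thesis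
    by blast
qed

text \<open>
  The new point is \<open>x g\<close> with \<open>g \<notin> K\<close> close to the unit: it is joined to \<open>x\<close> because \<open>g \<notin> K\<close>, and to
  the other members of \<open>F\<close> because \<open>x\<close> is and the edge set is open.
\<close>

lemma extend_clique_nearby:
  assumes K: "closedin T K" "\<one> \<in> K" "\<And>g. g \<in> K \<Longrightarrow> inv g \<in> K"
    and nbhd: "\<And>U. openin T U \<Longrightarrow> \<one> \<in> U \<Longrightarrow> \<not> U \<subseteq> K"
    and F: "finite F" "F \<subseteq> carrier G" "pairwise (\<lambda>x y. inv x \<otimes> y \<notin> K) F"
    and x: "x \<in> F" "openin T W" "x \<in> W"
  shows "\<exists>y\<in>W. y \<noteq> x \<and> pairwise (\<lambda>x y. inv x \<otimes> y \<notin> K) (insert y F)"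
proof -
  define W' where "W' = W \<inter> (\<Inter>h\<in>F - {x}. {y \<in> carrier G. inv h \<otimes> y \<notin> K})"
  have xG: "x \<in> carrier G"
    using x F by auto
  have op: "openin T {y \<in> carrier G. inv h \<otimes> y \<notin> K}" if "h \<in> carrier G" for h
  proof -
    have "openin T {y \<in> topspace T. inv h \<otimes> y \<in> topspace T - K}"
      using that K(1) by (intro openin_continuous_map_preimage[OF continuous_map_translation]) auto
    also have "{y \<in> topspace T. inv h \<otimes> y \<in> topspace T - K} = {y \<in> carrier G. inv h \<otimes> y \<notin> K}"
      using that by (auto simp: topspace_eq_carrier)
    finally show ?thesis .
  qed
  have W': "openin T W'"
  proof (cases "F - {x} = {}")
    case True
    then show ?thesis
      using x(2) unfolding W'_def True by simp
  next
    case False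
    then show ?thesis
      unfolding W'_def using x(2) F(1,2) op by (intro openin_Int openin_INT2) auto
  qed
  have W'G: "W' \<subseteq> carrier G"
    using openin_subset[OF W'] by (simp add: topspace_eq_carrier)
  have "x \<in> W'"
    using x xG F by (auto simp: W'_def pairwise_def)
  then have "\<one> \<in> inv x <# W'"
    using xG W'G by (simp add: l_coset_mem_iff)
  then obtain g where g: "g \<in> inv x <# W'" "g \<notin> K"
    using nbhd openin_translate[OF W', of "inv x"] xG by blast
  then obtain y where y: "y \<in> W'" "g = inv x \<otimes> y"
    by (auto simp: l_coset_def)
  have yG: "y \<in> carrier G"
    using y W'G by blast
  have new: "inv h \<otimes> y \<notin> K" if "h \<in> F" for h
    using that y g(2) by (cases "h = x") (auto simp: W'_def)
  moreover have "inv y \<otimes> h \<notin> K" if "h \<in> F" for h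
    using new[OF that] K(3)[of "inv y \<otimes> h"] inv_ldiv[OF yG, of h] that F(2) by auto
  moreover have "y \<noteq> x"
    using y g K(2) xG by auto
  ultimately show ?thesis
    using y(1) F(3) by (intro bexI[of _ y]) (auto simp: pairwise_insert W'_def)
qed

end


section \<open>Packings in Polish groups\<close>

context polish_group
begin

lemma metrizable: "metrizable_space T"
  by (rule completely_metrizable_imp_metrizable_space[OF completely_metrizable])

lemma Hausdorff: "Hausdorff_space T"
  by (rule metrizable_imp_Hausdorff_space[OF metrizable])

lemma carrier_lepoll_reals: "carrier G \<lesssim> (UNIV :: real set)"
proof -
  have "second_countable T"
    using metrizable separable by (rule separable_metrizable_imp_second_countable)
  then have "topspace T \<lesssim> (UNIV :: real set)"
    using Hausdorff by (intro second_countable_t0_imp_lepoll_reals Hausdorff_imp_t1_space t1_imp_t0_space)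
  then show ?thesis
    by (simp add: topspace_eq_carrier)
qed

lemma packing_index_eq_continuum:
  assumes "S \<in> packings G A" "(UNIV :: real set) \<lesssim> S"
  shows "packing_index G A =o |UNIV :: real set|"
  unfolding packing_index_eq
proof (rule card_Sup_eq_card_of[OF assms])
  fix S' assume "S' \<in> packings G A"
  then have "S' \<lesssim> carrier G"
    by (intro subset_imp_lepoll) (simp add: packings_def)
  then show "S' \<lesssim> (UNIV :: real set)"
    using carrier_lepoll_reals by (rule lepoll_trans)
qed

text \<open>
  The quotients of the pairs of compact pieces of \<open>A\<close> exhaust \<open>A A\<^sup>-\<^sup>1\<close>; they make the edge set of
  the packing graph a \<open>G\<^sub>\<delta>\<close>.
\<close>

lemma quotients_sigma_compact:
  assumes "sigma_compactin T A" "A \<noteq> {}"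
  obtains K :: "nat \<Rightarrow> 'a set" where "\<forall>n. compactin T (K n)" "quotients G A A = (\<Union>n. K n)"
proof -
  obtain \<C> where \<C>: "countable \<C>" "\<C> \<subseteq> Collect (compactin T)" "\<Union>\<C> = A"
    using assms(1) unfolding sigma_compactin_def union_of_def by auto
  have ne: "\<C> \<times> \<C> \<noteq> {}"
    using \<C>(3) assms(2) by auto
  have count: "countable (\<C> \<times> \<C>)"
    using \<C>(1) by simp
  define K where "K n = (case from_nat_into (\<C> \<times> \<C>) n of (C, D) \<Rightarrow> quotients G C D)" for n
  have "\<forall>n. compactin T (K n)"
  proof
    fix n
    show "compactin T (K n)"
      using from_nat_into[OF ne, of n] \<C>(2) by (auto simp: K_def intro!: compactin_quotients)
  qed
  moreover have "quotients G A A = (\<Union>n. K n)"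
  proof -
    have "(\<Union>n. K n) = (\<Union>p\<in>range (from_nat_into (\<C> \<times> \<C>)). case p of (C, D) \<Rightarrow> quotients G C D)"
      by (simp add: K_def)
    also have "\<dots> = (\<Union>C\<in>\<C>. \<Union>D\<in>\<C>. quotients G C D)"
      unfolding range_from_nat_into[OF ne count] by auto
    also have "\<dots> = quotients G A A"
      unfolding \<C>(3)[symmetric] quotients_def by fast
    finally show ?thesis
      by (rule sym)
  qed
  ultimately show thesis
    by (rule that)
qed

lemma uncountable_packing_imp_continuum_packing:
  assumes A: "A \<subseteq> carrier G" "A \<noteq> {}" "sigma_compactin T A"
    and S: "S \<in> packings G A" "uncountable S"
  shows "\<exists>P\<in>packings G A. (UNIV :: real set) \<lesssim> P"
proof -
  obtain K :: "nat \<Rightarrow> 'a set" where K: "\<forall>n. compactin T (K n)" "quotients G A A = (\<Union>n. K n)"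
    using A(3,2) by (rule quotients_sigma_compact)
  define U where "U n = {p \<in> carrier G \<times> carrier G. inv (fst p) \<otimes> snd p \<notin> K n}" for n
  have op: "openin (prod_topology T T) (U n)" for n
    unfolding U_def using Hausdorff K(1) by (intro openin_ldiv_notin compactin_imp_closedin) auto
  have U: "X \<in> packings G A \<longleftrightarrow> pairwise (\<lambda>x y. (x, y) \<in> (\<Inter>n. U n)) X"
    if "X \<subseteq> carrier G" for X
    using that unfolding packings_iff_clique[OF A(1)] K(2)
    by (auto simp: pairwise_def U_def subset_iff)
  have SG: "S \<subseteq> carrier G"
    using S(1) by (simp add: packings_def)
  have "\<exists>P\<subseteq>topspace T. (UNIV :: real set) \<lesssim> P \<and> pairwise (\<lambda>x y. (x, y) \<in> (\<Inter>n. U n)) P"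
  proof (rule uncountable_clique_imp_continuum_clique[OF completely_metrizable separable op _ S(2)])
    show "S \<subseteq> topspace T"
      using SG by (simp add: topspace_eq_carrier)
    show "pairwise (\<lambda>x y. (x, y) \<in> (\<Inter>n. U n)) S"
      using S(1) U[OF SG] by simp
  qed
  then show ?thesis
    using U unfolding topspace_eq_carrier by blast
qed

text \<open>
  Besides the values, the case of a finite index records that the packings are then bounded, so that
  one infinite packing rules this case out.
\<close>

lemma packing_index_trichotomy:
  assumes "A \<subseteq> carrier G" "A \<noteq> {}" "sigma_compactin T A"
  shows "(\<exists>n::nat. n > 0 \<and> packing_index G A =o |{..<n}| ) \<and>
        (\<exists>N. \<forall>S\<in>packings G A. finite S \<and> card S \<le> N) \<or>
      packing_index G A =o |UNIV :: nat set| \<or>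
      packing_index G A =o |UNIV :: real set|"
proof (cases "\<exists>P\<in>packings G A. (UNIV :: real set) \<lesssim> P")
  case True
  then show ?thesis
    using packing_index_eq_continuum by blast
next
  case False
  then have count: "\<And>S. S \<in> packings G A \<Longrightarrow> countable S"
    using uncountable_packing_imp_continuum_packing[OF assms] by blast
  show ?thesis
  proof (cases "\<exists>N. \<forall>S\<in>packings G A. finite S \<and> card S \<le> N")
    case True
    then show ?thesis
      using packing_index_finite by blast
  next
    case False
    from card_Sup_countable[OF count this] show ?thesis
      unfolding packing_index_eq by blast
  qed
qed

text \<open>
  If a maximal packing were countable, the group would be a countable union of compact translates
  \<open>x A A\<^sup>-\<^sup>1\<close>. One of them would have interior points by Baire's theorem, and homogeneity would give
  every point a compact neighbourhood.
\<close>

lemma uncountable_packing_if_not_locally_compact: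
  assumes A: "A \<subseteq> carrier G" "A \<noteq> {}" "compactin T A" and "\<not> locally_compact_space T"
  shows "\<exists>S\<in>packings G A. uncountable S"
proof -
  let ?K = "quotients G A A"
  obtain S where S: "S \<in> packings G A" "(\<Union>x\<in>S. x <# ?K) = carrier G"
    using A(1,2) by (rule maximal_packing_covers)
  have SG: "S \<subseteq> carrier G"
    using S(1) by (simp add: packings_def)
  have comp: "compactin T (x <# ?K)" if "x \<in> S" for x
    using that SG A(3) by (intro compactin_translate compactin_quotients) auto
  have "uncountable S"
  proof
    assume "countable S"
    have "T interior_of \<Union>((\<lambda>x. x <# ?K) ` S) = {}"
    proof (rule Baire_category_alt)
      show "countable ((\<lambda>x. x <# ?K) ` S)"
        using \<open>countable S\<close> by simp
      fix B assume "B \<in> (\<lambda>x. x <# ?K) ` S"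
      then have B: "compactin T B"
        using comp by blast
      have "T interior_of B = {}"
      proof (rule ccontr)
        assume "T interior_of B \<noteq> {}"
        from locally_compact_if_compact_nbhd[OF B openin_interior_of this interior_of_subset]
        show False
          using assms(4) by blast
      qed
      then show "closedin T B \<and> T interior_of B = {}"
        using compactin_imp_closedin[OF Hausdorff B] by blast
    qed (use completely_metrizable in blast)
    then have "T interior_of (topspace T) = {}"
      by (simp add: S(2) topspace_eq_carrier)
    then show False
      using one_closed by (simp add: topspace_eq_carrier[symmetric])
  qed
  with S(1) show ?thesis
    by blast
qed

lemma infinite_packing_if_not_compact:
  assumes A: "A \<subseteq> carrier G" "A \<noteq> {}" "compactin T A" and "\<not> compact_space T"
  shows "\<exists>S\<in>packings G A. infinite S"
proof -
  let ?K = "quotients G A A"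
  obtain S where S: "S \<in> packings G A" "(\<Union>x\<in>S. x <# ?K) = carrier G"
    using A(1,2) by (rule maximal_packing_covers)
  have SG: "S \<subseteq> carrier G"
    using S(1) by (simp add: packings_def)
  have "infinite S"
  proof
    assume "finite S"
    then have "compactin T (\<Union>((\<lambda>x. x <# ?K) ` S))"
      using SG A(3) by (intro compactin_Union) (auto intro!: compactin_translate compactin_quotients)
    then show False
      using assms(4) by (simp add: S(2) compact_space_def topspace_eq_carrier)
  qed
  with S(1) show ?thesis
    by blast
qed

text \<open>
  Here \<open>A A\<^sup>-\<^sup>1\<close> is closed, so the edge set is open and finite packings can be enlarged near any of
  their points; the result of the iteration feeds the Cantor scheme with a constant sequence of open
  sets.
\<close>

lemma continuum_packing_if_not_nbhd:
  assumes A: "A \<subseteq> carrier G" "A \<noteq> {}" "closedin T (quotients G A A)"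
    and nbhd: "\<And>U. openin T U \<Longrightarrow> \<one> \<in> U \<Longrightarrow> \<not> U \<subseteq> quotients G A A"
  shows "\<exists>P\<in>packings G A. (UNIV :: real set) \<lesssim> P"
proof -
  let ?K = "quotients G A A"
  let ?R = "\<lambda>x y. inv x \<otimes> y \<notin> ?K"
  define U where "U = {p \<in> carrier G \<times> carrier G. inv (fst p) \<otimes> snd p \<notin> ?K}"
  have op: "openin (prod_topology T T) U"
    unfolding U_def by (rule openin_ldiv_notin[OF A(3)])
  have U: "pairwise ?R X \<longleftrightarrow> pairwise (\<lambda>x y. (x, y) \<in> (\<Inter>n::nat. U)) X"
    if "X \<subseteq> carrier G" for X
    using that by (auto simp: pairwise_def U_def subset_iff)
  obtain D where D: "D \<noteq> {}" "D \<subseteq> T derived_set_of D" "pairwise ?R D"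
  proof (rule dense_in_itself_clique_exists[OF metrizable])
    show "topspace T \<noteq> {}"
      using one_closed by (auto simp: topspace_eq_carrier)
    fix F x W assume "finite F" "F \<subseteq> topspace T" "pairwise ?R F" "x \<in> F" "openin T W" "x \<in> W"
    then show "\<exists>y\<in>W. y \<noteq> x \<and> pairwise ?R (insert y F)"
      using extend_clique_nearby[OF A(3) one_in_quotients[OF A(1,2)] inv_in_quotients[OF A(1)] nbhd]
      by (simp add: topspace_eq_carrier)
  qed
  have "D \<subseteq> carrier G"
    using D(2) derived_set_of_subset_topspace[of T D] by (auto simp: topspace_eq_carrier)
  then have "pairwise (\<lambda>x y. (x, y) \<in> (\<Inter>n::nat. U)) D"
    using U D(3) by blast
  then have "\<exists>P\<subseteq>topspace T. (UNIV :: real set) \<lesssim> P \<and> pairwise (\<lambda>x y. (x, y) \<in> (\<Inter>n::nat. U)) P"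
    by (rule dense_in_itself_clique_imp_continuum_clique[OF completely_metrizable op D(1,2)])
  then obtain P where P: "P \<subseteq> carrier G" "(UNIV :: real set) \<lesssim> P"
    "pairwise (\<lambda>x y. (x, y) \<in> (\<Inter>n::nat. U)) P"
    unfolding topspace_eq_carrier by (elim exE conjE) (rule that)
  have "P \<in> packings G A"
    unfolding packings_iff_clique[OF A(1)] U[OF P(1)] using P(1,3) by (rule conjI)
  with P(2) show ?thesis
    by (rule bexI)
qed

end

theorem theorem1:
  fixes G :: "('a, 'm) monoid_scheme" and T :: "'a topology" and A :: "'a set"
  assumes "polish_group G T"
    and "A \<subseteq> carrier G" and "A \<noteq> {}" and "sigma_compactin T A"
  shows "((\<exists>n::nat. n > 0 \<and> packing_index G A =o |{..<n}| ) \<or>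
           packing_index G A =o |UNIV :: nat set| \<or>
           packing_index G A =o |UNIV :: real set| ) \<and>
         (compactin T A \<longrightarrow>
           (\<not> locally_compact_space T \<longrightarrow> packing_index G A =o |UNIV :: real set| ) \<and>
           (locally_compact_space T \<and> \<not> compact_space T \<longrightarrow>
              packing_index G A =o |UNIV :: nat set| \<or>
              packing_index G A =o |UNIV :: real set| ) \<and>
           (compact_space T \<longrightarrow>
              (\<exists>n::nat. n > 0 \<and> packing_index G A =o |{..<n}| ) \<or>
              packing_index G A =o |UNIV :: real set| ))"
proof -
  interpret polish_group G T
    by (rule assms(1))
  note tri = packing_index_trichotomy[OF assms(2-4)]
  have 1: "packing_index G A =o |UNIV :: real set|" if lc: "compactin T A" "\<not> locally_compact_space T"
  proof -
    obtain S where "S \<in> packings G A" "uncountable S"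
      using uncountable_packing_if_not_locally_compact[OF assms(2,3) lc] by blast
    then show ?thesis
      using uncountable_packing_imp_continuum_packing[OF assms(2-4)] packing_index_eq_continuum by blast
  qed
  have 2: "packing_index G A =o |UNIV :: nat set| \<or> packing_index G A =o |UNIV :: real set|"
    if nc: "compactin T A" "\<not> compact_space T"
  proof -
    obtain S where "S \<in> packings G A" "infinite S"
      using infinite_packing_if_not_compact[OF assms(2,3) nc] by blast
    then show ?thesis
      using tri by blast
  qed
  have 3: "(\<exists>n::nat. n > 0 \<and> packing_index G A =o |{..<n}| ) \<or> packing_index G A =o |UNIV :: real set|"
    if "compactin T A" "compact_space T"
  proof (cases "\<exists>U. openin T U \<and> \<one>\<^bsub>G\<^esub> \<in> U \<and> U \<subseteq> quotients G A A")
    case True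
    then obtain U where U: "openin T U" "\<one>\<^bsub>G\<^esub> \<in> U" "U \<subseteq> quotients G A A"
      by blast
    show ?thesis
      using packing_index_finite[OF bounded_packings[OF that(2) assms(2) U]] by (rule disjI1)
  next
    case False
    have "closedin T (quotients G A A)"
      by (rule compactin_imp_closedin[OF Hausdorff compactin_quotients[OF that(1) that(1)]])
    then show ?thesis
      using continuum_packing_if_not_nbhd[OF assms(2,3)] False packing_index_eq_continuum by blast
  qed
  show ?thesis
    using tri 1 2 3 by blast
qed

end
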